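(* Let $f=\sum_{i=1}^m c_i\mathbf{x}^{\boldsymbol{\alpha}_i}-\sum_{j=1}^l d_j\mathbf{x}^{\boldsymbol{\beta}_j}\in\mathbb{R}[x_1,\ldots,x_n]$ with $\boldsymbol{\alpha}_i\in(2\mathbb{N})^n$, $c_i>0$ for $i=1,\ldots,m$, and $\boldsymbol{\beta}_j\in\mathbb{N}^n$ lying in the relative interior of $\mathrm{New}(f)$, $d_j\in\mathbb{R}$, for $j=1,\ldots,l$. Assume that $\mathrm{New}(f)$ is simple at some vertex, that all $\boldsymbol{\beta}_j$ lie in the same side of every hyperplane determined by points among $\{\boldsymbol{\alpha}_1,\ldots,\boldsymbol{\alpha}_m\}$, and that there exists a point $\boldsymbol{v}\in(\mathbb{R}\setminus\{0\})^n$ such that $d_j\boldsymbol{v}^{\boldsymbol{\beta}_j}>0$ for all $j$. Then $f\in\mathrm{PSD}$ if and only if $f\in\mathrm{SONC}$.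
   Context: Here $\mathbb{N}$ contains $0$, and $\mathbf{x}^{\boldsymbol{\alpha}}=x_1^{\alpha_1}\cdots x_n^{\alpha_n}$. $\mathrm{New}(f)$ is the Newton polytope of $f$, i.e. the convex hull of its support (the exponents with nonzero coefficient). A polytope $\Delta$ of dimension $d$ is simple at a vertex $\boldsymbol{\alpha}$ if $\boldsymbol{\alpha}$ is the intersection of precisely $d$ edges of $\Delta$. "Hyperplane determined by points among $\{\boldsymbol{\alpha}_1,\ldots,\boldsymbol{\alpha}_m\}$" means a hyperplane spanned by affinely independent points of this set, a hyperplane being taken in $\mathbb{R}^n$ when $\dim\mathrm{New}(f)=n$, and in general in the affine hull of $\mathrm{New}(f)$; "in the same side" means in the same open half-space bounded by the hyperplane (in particular no $\boldsymbol{\beta}_j$ lies on it). $\mathrm{PSD}$ is the set of polynomials in $\mathbb{R}[x_1,\ldots,x_n]$ that are nonnegative on all of $\mathbb{R}^n$. A trellis is a finite set $\mathscr{A}\subseteq(2\mathbb{N})^n$ comprising the vertices of a simplex (of any dimension). A circuit polynomial is a polynomial of the form $\sum_{\boldsymbol{\alpha}\in\mathscr{A}}c_{\boldsymbol{\alpha}}\mathbf{x}^{\boldsymbol{\alpha}}-d\mathbf{x}^{\boldsymbol{\beta}}$ where $\mathscr{A}$ is a trellis, $c_{\boldsymbol{\alpha}}>0$ for all $\boldsymbol{\alpha}\in\mathscr{A}$, $d\in\mathbb{R}$, and $\boldsymbol{\beta}\in\mathbb{N}^n$ lies in the relative interior of the convex hull of $\mathscr{A}$. A nonnegative circuit polynomial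 is a circuit polynomial that is nonnegative on $\mathbb{R}^n$; by convention a monomial square $c\mathbf{x}^{\boldsymbol{\alpha}}$ with $c>0$, $\boldsymbol{\alpha}\in(2\mathbb{N})^n$ is also regarded as one. $\mathrm{SONC}$ is the convex cone of all (finite, possibly empty) sums of nonnegative circuit polynomials. *)

theory Defs
  imports "HOL-Analysis.Analysis" "HOL-Library.Poly_Mapping"
begin

text \<open>
  Real polynomials in the variables indexed by the finite type \<open>'n\<close>, as the monoid algebra
  over the exponent vectors: \<open>lookup f \<alpha>\<close> is the coefficient of the monomial with exponent
  \<open>\<alpha>\<close>, and \<open>keys f\<close> is the support of \<open>f\<close>.
\<close>
type_synonym 'n rpoly = "(nat ^ 'n) \<Rightarrow>\<^sub>0 real"

definition mono_eval :: "real ^ 'n \<Rightarrow> nat ^ 'n \<Rightarrow> real" where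
  "mono_eval x \<alpha> = (\<Prod>i\<in>UNIV. (x $ i) ^ (\<alpha> $ i))"

definition poly_eval :: "'n::finite rpoly \<Rightarrow> real ^ 'n \<Rightarrow> real" where
  "poly_eval f x = (\<Sum>\<alpha>\<in>Poly_Mapping.keys f. Poly_Mapping.lookup f \<alpha> * mono_eval x \<alpha>)"

definition PSD :: "'n::finite rpoly set" where
  "PSD = {f. \<forall>x. 0 \<le> poly_eval f x}"

definition rvec :: "nat ^ 'n \<Rightarrow> real ^ 'n" where
  "rvec \<alpha> = (\<chi> i. real (\<alpha> $ i))"

definition even_exp :: "nat ^ 'n \<Rightarrow> bool" where
  "even_exp \<alpha> \<longleftrightarrow> (\<forall>i. even (\<alpha> $ i))"

definition New :: "'n::finite rpoly \<Rightarrow> (real ^ 'n) set" where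
  "New f = convex hull (rvec ` Poly_Mapping.keys f)"

definition simple_at :: "'a::euclidean_space set \<Rightarrow> 'a \<Rightarrow> bool" where
  "simple_at P v \<longleftrightarrow>
     v extreme_point_of P \<and> int (card {e. e edge_of P \<and> v \<in> e}) = aff_dim P"

text \<open>
  Hyperplanes are taken inside the affine hull of \<open>P\<close>. Requiring \<open>S \<noteq> {}\<close> only matters
  when \<open>P\<close> is a point, where it keeps the empty set (of dimension \<open>-1\<close>) from counting as a
  hyperplane.
\<close>
definition determined_hyperplanes ::
    "'a::euclidean_space set \<Rightarrow> 'a set \<Rightarrow> 'a set set" where
  "determined_hyperplanes P A =
     {affine hull S | S. S \<subseteq> A \<and> S \<noteq> {} \<and> \<not> affine_dependent S \<and>
        affine hull S \<subseteq> affine hull P \<and> aff_dim (affine hull S) = aff_dim P - 1}"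

text \<open>
  \<open>B\<close> lies in one of the two open half-spaces of the affine space \<open>V\<close> bounded by the
  hyperplane \<open>H\<close> of \<open>V\<close>; negating \<open>a\<close> and \<open>b\<close> exchanges the two sides.
\<close>
definition same_side :: "'a::euclidean_space set \<Rightarrow> 'a set \<Rightarrow> 'a set \<Rightarrow> bool" where
  "same_side V H B \<longleftrightarrow>
     (\<exists>a b. a \<noteq> 0 \<and> H = {x \<in> V. a \<bullet> x = b} \<and> B \<subseteq> {x \<in> V. a \<bullet> x > b})"

definition trellis :: "(nat ^ 'n::finite) set \<Rightarrow> bool" where
  "trellis A \<longleftrightarrow> finite A \<and> (\<forall>\<alpha>\<in>A. even_exp \<alpha>) \<and>
     (\<exists>k::nat. \<exists>S. int k simplex S \<and> rvec ` A = {v. v extreme_point_of S})"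

definition circuit_poly :: "'n::finite rpoly \<Rightarrow> bool" where
  "circuit_poly p \<longleftrightarrow>
     (\<exists>A c \<beta> d. trellis A \<and> (\<forall>\<alpha>\<in>A. 0 < c \<alpha>) \<and>
        rvec \<beta> \<in> rel_interior (convex hull (rvec ` A)) \<and>
        p = (\<Sum>\<alpha>\<in>A. Poly_Mapping.single \<alpha> (c \<alpha>)) - Poly_Mapping.single \<beta> d)"

definition nonneg_circuit_poly :: "'n::finite rpoly \<Rightarrow> bool" where
  "nonneg_circuit_poly p \<longleftrightarrow>
     (circuit_poly p \<and> p \<in> PSD) \<or>
     (\<exists>\<alpha> c. even_exp \<alpha> \<and> 0 < c \<and> p = Poly_Mapping.single \<alpha> c)"

definition SONC :: "'n::finite rpoly set" where
  "SONC = {f. \<exists>ps. (\<forall>p\<in>set ps. nonneg_circuit_poly p) \<and> f = sum_list ps}"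

end

theory Submission
  imports Defs
begin

text \<open>
  Every nonnegative circuit polynomial is nonnegative, so only one direction needs an argument.

  Flipping the signs of the coordinates as \<open>v\<close> does makes every inner term (one with exponent
  \<open>\<beta>\<^sub>j\<close>) enter with a negative sign. In logarithmic coordinates \<open>y\<close>, nonnegativity of \<open>f\<close> then
  says that the exponential sum \<open>G y\<close> of the terms \<open>c\<^sub>i exp (\<alpha>\<^sub>i \<bullet> y)\<close> dominates the sum \<open>D y\<close> of the
  terms \<open>\<bar>d\<^sub>j\<bar> exp (\<beta>\<^sub>j \<bullet> y)\<close>. As the \<open>\<beta>\<^sub>j\<close> lie in the relative interior of the Newton polytope, the
  ratio \<open>G / D\<close> attains its minimum \<open>t \<ge> 1\<close>. The value of the ratio and the vanishing of its
  derivative there say that the weights \<open>w\<^sub>i = c\<^sub>i exp (\<alpha>\<^sub>i \<bullet> y)\<close> on the points \<open>\<alpha>\<^sub>i\<close> and the weights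
  \<open>e\<^sub>j = t \<bar>d\<^sub>j\<bar> exp (\<beta>\<^sub>j \<bullet> y)\<close> on the points \<open>\<beta>\<^sub>j\<close> have the same total mass and the same
  barycentre \<open>x\<close> (\<open>exp_sum_ratio_critical_point\<close>).

  It remains to distribute the weights \<open>w\<close> among the \<open>\<beta>\<^sub>j\<close>: each \<open>\<beta>\<^sub>j\<close> should be balanced by its
  own share, after which AM-GM applies to it separately (\<open>nonneg_circuit_if_am_gm\<close>). By
  Caratheodory's argument \<open>w\<close> is a sum of weights with barycentre \<open>x\<close> and affinely independent
  support (\<open>weights_induct\<close>). This is where the hyperplane condition enters: a simplex
  with vertices among the \<open>\<alpha>\<^sub>i\<close> that contains \<open>x\<close> has all the \<open>\<beta>\<^sub>j\<close> in its relative interior, because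
  \<open>x\<close> lies in their convex hull and no hyperplane spanned by the \<open>\<alpha>\<^sub>i\<close> separates them or meets this
  hull (\<open>chamber_subset_simplex\<close>). Each summand of \<open>w\<close> therefore splits according to the
  barycentric coordinates of the \<open>\<beta>\<^sub>j\<close> in its simplex, and each piece is a nonnegative circuit
  polynomial on the vertices of that simplex (\<open>SONC_if_balanced\<close>).
\<close>

section \<open>Evaluating polynomials\<close>

lemma poly_eval_superset:
  assumes "finite T" "Poly_Mapping.keys f \<subseteq> T"
  shows "poly_eval f x = (\<Sum>\<alpha>\<in>T. Poly_Mapping.lookup f \<alpha> * mono_eval x \<alpha>)"
  unfolding poly_eval_def
  by (rule sum.mono_neutral_left[OF assms]) (auto simp: in_keys_iff)

lemma poly_eval_0 [simp]: "poly_eval 0 x = 0"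
  by (simp add: poly_eval_def)

lemma poly_eval_add: "poly_eval (f + g) x = poly_eval f x + poly_eval g x"
proof -
  let ?T = "Poly_Mapping.keys f \<union> Poly_Mapping.keys g"
  have "Poly_Mapping.keys (f + g) \<subseteq> ?T"
    by (rule Poly_Mapping.keys_add)
  then show ?thesis
    by (simp add: poly_eval_superset[of ?T] lookup_add distrib_right sum.distrib)
qed

lemma poly_eval_diff: "poly_eval (f - g) x = poly_eval f x - poly_eval g x"
  using poly_eval_add[of "f - g" g x] by simp

lemma poly_eval_sum: "poly_eval (sum F I) x = (\<Sum>i\<in>I. poly_eval (F i) x)"
  by (induction I rule: infinite_finite_induct) (simp_all add: poly_eval_add)

lemma poly_eval_single [simp]:
  "poly_eval (Poly_Mapping.single \<alpha> k) x = k * mono_eval x \<alpha>"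
  by (subst poly_eval_superset[of "{\<alpha>}"]) auto

lemma single_sum:
  "Poly_Mapping.single \<alpha> (sum h I) = (\<Sum>i\<in>I. Poly_Mapping.single \<alpha> (h i))"
  by (induction I rule: infinite_finite_induct) (simp_all add: single_add)

lemma mono_eval_even_nonneg: "even_exp \<alpha> \<Longrightarrow> 0 \<le> mono_eval x \<alpha>"
  unfolding mono_eval_def even_exp_def by (intro prod_nonneg) (auto intro: zero_le_even_power)

text \<open>In logarithmic coordinates a monomial is the exponential of a linear form.\<close>

lemma abs_mono_eval_eq_exp:
  assumes "\<And>i. x $ i \<noteq> 0"
  shows "\<bar>mono_eval x \<alpha>\<bar> = exp (rvec \<alpha> \<bullet> (\<chi> i. ln \<bar>x $ i\<bar>))"
  using assms
  by (simp add: mono_eval_def rvec_def inner_vec_def exp_sum exp_of_nat_mult abs_prod power_abs)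

lemma mono_eval_even_eq_exp:
  assumes "even_exp \<alpha>" "\<And>i. x $ i \<noteq> 0"
  shows "mono_eval x \<alpha> = exp (rvec \<alpha> \<bullet> (\<chi> i. ln \<bar>x $ i\<bar>))"
  using abs_mono_eval_eq_exp[OF assms(2), of \<alpha>] mono_eval_even_nonneg[OF assms(1), of x] by simp

lemma inj_rvec: "inj rvec"
  by (auto simp: inj_def rvec_def vec_eq_iff)

lemma continuous_poly_eval: "continuous_on UNIV (poly_eval f)"
  unfolding poly_eval_def mono_eval_def by (intro continuous_intros)

text \<open>
  Logarithmic coordinates miss the points with a zero coordinate; since these are limits of
  points without, nonnegativity need not be tested there.
\<close>

lemma PSD_if_nonneg_off_axes:
  assumes nn: "\<And>x. (\<And>i. x $ i \<noteq> 0) \<Longrightarrow> 0 \<le> poly_eval f x"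
  shows "f \<in> PSD"
proof -
  have "0 \<le> poly_eval f x" for x
  proof -
    let ?g = "\<lambda>s. x + s *\<^sub>R (\<chi> i. 1)"
    have "\<forall>\<^sub>F s in at_right 0. s \<noteq> - (x $ i)" for i
    proof (cases "x $ i = 0")
      case True
      then show ?thesis using eventually_at_right_less[of "0::real"] by (auto elim: eventually_mono)
    next
      case False
      then show ?thesis by (intro tendsto_imp_eventually_ne[OF tendsto_ident_at]) simp
    qed
    then have "\<forall>\<^sub>F s in at_right 0. \<forall>i. s \<noteq> - (x $ i)"
      by (rule eventually_all_finite)
    then have ev: "\<forall>\<^sub>F s in at_right 0. 0 \<le> poly_eval f (?g s)"
      by eventually_elim (rule nn, auto simp: add_eq_0_iff)
    have "((\<lambda>s. poly_eval f (?g s)) \<longlongrightarrow> poly_eval f (?g 0)) (at_right 0)"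
    proof (rule isCont_tendsto_compose[where g = "poly_eval f"])
      show "isCont (poly_eval f) (?g 0)"
        using continuous_poly_eval continuous_on_eq_continuous_at[OF open_UNIV] by blast
      show "(?g \<longlongrightarrow> ?g 0) (at_right 0)"
        by (intro tendsto_intros)
    qed
    from tendsto_lowerbound[OF this ev] show ?thesis by simp
  qed
  then show ?thesis by (simp add: PSD_def)
qed

section \<open>Sums of nonnegative circuit polynomials\<close>

lemma nonneg_circuit_poly_imp_PSD: "nonneg_circuit_poly p \<Longrightarrow> p \<in> PSD"
  by (auto simp: nonneg_circuit_poly_def PSD_def mono_eval_even_nonneg)

lemma SONC_subset_PSD: "SONC \<subseteq> PSD"
proof
  fix f :: "'n::finite rpoly" assume "f \<in> SONC"
  then obtain ps where ps: "\<forall>p\<in>set ps. nonneg_circuit_poly p" and f: "f = sum_list ps"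
    by (auto simp: SONC_def)
  from ps have "0 \<le> poly_eval (sum_list ps) x" for x
    by (induction ps)
      (use nonneg_circuit_poly_imp_PSD in \<open>force simp: PSD_def poly_eval_add\<close>)+
  then show "f \<in> PSD" by (simp add: PSD_def f)
qed

lemma SONC_0: "0 \<in> SONC"
  by (auto simp: SONC_def intro: exI[of _ "[]"])

lemma SONC_nonneg_circuit: "nonneg_circuit_poly p \<Longrightarrow> p \<in> SONC"
  by (auto simp: SONC_def intro!: exI[of _ "[p]"])

lemma SONC_add:
  assumes "f \<in> SONC" "g \<in> SONC" shows "f + g \<in> SONC"
proof -
  obtain ps qs where "\<forall>p\<in>set ps. nonneg_circuit_poly p" "f = sum_list ps"
      "\<forall>p\<in>set qs. nonneg_circuit_poly p" "g = sum_list qs"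
    using assms by (auto simp: SONC_def)
  then show ?thesis
    by (auto simp: SONC_def intro!: exI[of _ "ps @ qs"])
qed

lemma SONC_sum: "(\<And>i. i \<in> I \<Longrightarrow> F i \<in> SONC) \<Longrightarrow> sum F I \<in> SONC"
  by (induction I rule: infinite_finite_induct) (auto simp: SONC_0 SONC_add)

lemma trellis_if_affine_independent:
  fixes S :: "(nat ^ 'n::finite) set"
  assumes "finite S" "S \<noteq> {}" "\<And>\<alpha>. \<alpha> \<in> S \<Longrightarrow> even_exp \<alpha>" "\<not> affine_dependent (rvec ` S)"
  shows "trellis S"
proof -
  have "0 < card (rvec ` S)"
    using assms(1,2) by (simp add: card_gt_0_iff)
  then have "int (card (rvec ` S) - 1) simplex (convex hull (rvec ` S))"
    using assms(4) by (intro simplex_convex_hull) linarith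
  moreover have "rvec ` S = {v. v extreme_point_of convex hull (rvec ` S)}"
    using extreme_point_of_convex_hull_affine_independent[OF assms(4)] by auto
  ultimately show ?thesis
    using assms(1,3) unfolding trellis_def by blast
qed

text \<open>
  Weighted AM-GM, in the form of Jensen's inequality for \<open>exp\<close>. The coefficients are normalised
  by the point \<open>exp y\<close>, at which all the terms \<open>exp (- (rvec \<alpha> \<bullet> y)) * mono_eval x \<alpha>\<close> equal 1. This
  is the equality case of AM-GM: the polynomial with the largest admissible \<open>\<delta>\<close> vanishes there.
\<close>

lemma nonneg_circuit_if_am_gm:
  fixes S :: "(nat ^ 'n::finite) set" and y :: "real ^ 'n"
  assumes S: "finite S" "\<And>\<alpha>. \<alpha> \<in> S \<Longrightarrow> even_exp \<alpha>" "\<not> affine_dependent (rvec ` S)"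
    and u: "\<And>\<alpha>. \<alpha> \<in> S \<Longrightarrow> 0 < u \<alpha>" "sum u S = 1" "(\<Sum>\<alpha>\<in>S. u \<alpha> *\<^sub>R rvec \<alpha>) = rvec \<beta>"
    and k: "0 < k" "\<bar>\<delta>\<bar> \<le> k * exp (- (rvec \<beta> \<bullet> y))"
  shows "nonneg_circuit_poly
    ((\<Sum>\<alpha>\<in>S. Poly_Mapping.single \<alpha> (k * u \<alpha> * exp (- (rvec \<alpha> \<bullet> y)))) - Poly_Mapping.single \<beta> \<delta>)"
    (is "nonneg_circuit_poly ?p")
proof -
  have "S \<noteq> {}" using u(2) by auto
  have "rvec \<beta> \<in> rel_interior (convex hull (rvec ` S))"
  proof -
    let ?U = "\<lambda>v. u (inv rvec v)"
    have inv: "inv rvec (rvec \<alpha>) = \<alpha>" for \<alpha> :: "nat ^ 'n"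
      by (simp add: inj_rvec)
    have "sum ?U (rvec ` S) = 1" "(\<Sum>v\<in>rvec ` S. ?U v *\<^sub>R v) = rvec \<beta>"
      using u by (simp_all add: sum.reindex inj_on_subset[OF inj_rvec] inv)
    then show ?thesis
      unfolding rel_interior_convex_hull_explicit[OF S(3)] using u(1)
      by (auto intro!: exI[of _ ?U] simp: inv)
  qed
  then have "circuit_poly ?p"
    unfolding circuit_poly_def
    using trellis_if_affine_independent[OF S(1) \<open>S \<noteq> {}\<close> S(2,3)] u(1) k(1)
    by (intro exI[of _ S] exI[of _ "\<lambda>\<alpha>. k * u \<alpha> * exp (- (rvec \<alpha> \<bullet> y))"] exI[of _ \<beta>] exI[of _ \<delta>])
      auto
  moreover have "?p \<in> PSD"
  proof (rule PSD_if_nonneg_off_axes)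
    fix x :: "real ^ 'n" assume x: "\<And>i. x $ i \<noteq> 0"
    define z where "z = (\<chi> i. ln \<bar>x $ i\<bar>)"
    have "\<delta> * mono_eval x \<beta> \<le> \<bar>\<delta>\<bar> * \<bar>mono_eval x \<beta>\<bar>"
      by (metis abs_ge_self abs_mult)
    also have "\<dots> = \<bar>\<delta>\<bar> * exp (rvec \<beta> \<bullet> z)"
      by (simp add: abs_mono_eval_eq_exp[OF x] z_def)
    also have "\<dots> \<le> (k * exp (- (rvec \<beta> \<bullet> y))) * exp (rvec \<beta> \<bullet> z)"
      by (intro mult_right_mono k) simp
    also have "\<dots> = k * exp (rvec \<beta> \<bullet> (z - y))"
      by (simp add: inner_diff_right exp_diff exp_minus field_simps)
    also have "rvec \<beta> \<bullet> (z - y) = (\<Sum>\<alpha>\<in>S. u \<alpha> *\<^sub>R (rvec \<alpha> \<bullet> (z - y)))"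
      by (simp add: u(3)[symmetric] inner_sum_left)
    also have "exp \<dots> \<le> (\<Sum>\<alpha>\<in>S. u \<alpha> * exp (rvec \<alpha> \<bullet> (z - y)))"
      using u(1) by (intro convex_on_sum[OF S(1) \<open>S \<noteq> {}\<close> exp_convex u(2)]) (auto intro: less_imp_le)
    also have "k * \<dots> = (\<Sum>\<alpha>\<in>S. (k * u \<alpha> * exp (- (rvec \<alpha> \<bullet> y))) * mono_eval x \<alpha>)"
      unfolding sum_distrib_left
      by (intro sum.cong)
        (simp_all add: mono_eval_even_eq_exp[OF S(2) x] z_def[symmetric] inner_diff_right exp_diff
          exp_minus field_simps)
    finally show "0 \<le> poly_eval ?p x"
      using k(1) by (simp add: poly_eval_diff poly_eval_sum)
  qed
  ultimately show ?thesis by (simp add: nonneg_circuit_poly_def)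
qed

section \<open>Point configurations\<close>

text \<open>
  Moving along a direction with a negative entry until the first weight vanishes: the step length is
  the least ratio \<open>w a / - \<mu> a\<close> over the negative entries, as in the simplex algorithm.
\<close>

lemma weights_shrink:
  fixes w \<mu> :: "'a \<Rightarrow> real"
  assumes "finite S" "\<And>a. a \<in> S \<Longrightarrow> 0 < w a" "\<exists>a\<in>S. \<mu> a < 0"
  obtains t where "0 < t" "\<And>a. a \<in> S \<Longrightarrow> 0 \<le> w a + t * \<mu> a" "\<exists>a\<in>S. w a + t * \<mu> a = 0"
proof -
  define N where "N = {a \<in> S. \<mu> a < 0}"
  define t where "t = Min ((\<lambda>a. w a / - \<mu> a) ` N)"
  have N: "finite N" "N \<noteq> {}" using assms by (auto simp: N_def)
  have "t \<in> (\<lambda>a. w a / - \<mu> a) ` N"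
    unfolding t_def using N by (intro Min_in) auto
  then obtain a0 where a0: "a0 \<in> N" "t = w a0 / - \<mu> a0" by auto
  show thesis
  proof
    show "0 < t" using a0 assms(2) by (auto simp: N_def divide_pos_neg)
    show "\<exists>a\<in>S. w a + t * \<mu> a = 0"
      using a0 by (intro bexI[of _ a0]) (auto simp: N_def)
    show "0 \<le> w a + t * \<mu> a" if "a \<in> S" for a
    proof (cases "\<mu> a < 0")
      case True
      then have "t \<le> w a / - \<mu> a"
        unfolding t_def using that N by (intro Min_le) (auto simp: N_def)
      then show ?thesis using True by (simp add: field_simps)
    next
      case False
      then show ?thesis using \<open>0 < t\<close> assms(2)[OF that] by simp
    qed
  qed
qed

text \<open>
  Caratheodory's argument for weights instead of points. An affine dependence \<open>\<mu>\<close> of the support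
  can be added to or subtracted from the weights until an entry vanishes; \<open>w\<close> lies between the two
  resulting weights, hence is the sum of rescalings of them, and both have smaller support, the same
  total mass and the same barycentre \<open>x\<close>. The rule thus proves a property that is preserved
  by sums from the case of affinely independent support.
\<close>

lemma weights_induct:
  fixes A :: "'a::real_vector set" and w :: "'a \<Rightarrow> real"
  assumes fin: "finite A" and "\<And>a. a \<in> A \<Longrightarrow> 0 \<le> w a"
    and "(\<Sum>a\<in>A. w a *\<^sub>R a) = sum w A *\<^sub>R x"
    and independent: "\<And>w S. S \<subseteq> A \<Longrightarrow> \<not> affine_dependent S \<Longrightarrow> (\<And>a. a \<in> S \<Longrightarrow> 0 < w a) \<Longrightarrow>
      (\<And>a. a \<in> A - S \<Longrightarrow> w a = 0) \<Longrightarrow> (\<Sum>a\<in>S. w a *\<^sub>R a) = sum w S *\<^sub>R x \<Longrightarrow> Q w"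
    and add: "\<And>w1 w2. Q w1 \<Longrightarrow> Q w2 \<Longrightarrow> Q (\<lambda>a. w1 a + w2 a)"
  shows "Q w"
  using assms(2,3)
proof (induction "card {a \<in> A. 0 < w a}" arbitrary: w rule: less_induct)
  case less
  define S where "S = {a \<in> A. 0 < w a}"
  have S: "S \<subseteq> A" "finite S" and pos: "\<And>a. a \<in> S \<Longrightarrow> 0 < w a"
    and zero: "\<And>a. a \<in> A - S \<Longrightarrow> w a = 0"
    using fin less.prems(1) by (auto simp: S_def intro: antisym)
  show ?case
  proof (cases "affine_dependent S")
    case False
    have "(\<Sum>a\<in>S. w a *\<^sub>R a) = sum w S *\<^sub>R x"
      using less.prems(2) S zero
        sum.mono_neutral_right[OF fin S(1), of "\<lambda>a. w a *\<^sub>R a"]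
        sum.mono_neutral_right[OF fin S(1), of w] by simp
    then show ?thesis using independent[OF S(1) False] pos zero by blast
  next
    case True
    then obtain U where U: "sum U S = 0" "\<exists>v\<in>S. U v \<noteq> 0" "(\<Sum>v\<in>S. U v *\<^sub>R v) = 0"
      using affine_dependent_explicit_finite[OF S(2)] by auto
    define \<mu> where "\<mu> a = (if a \<in> S then U a else 0)" for a
    have \<mu>: "sum \<mu> A = 0" "(\<Sum>a\<in>A. \<mu> a *\<^sub>R a) = 0" "\<exists>v\<in>S. \<mu> v \<noteq> 0" "sum \<mu> S = 0"
      using U sum.mono_neutral_right[OF fin S(1), of \<mu>]
        sum.mono_neutral_right[OF fin S(1), of "\<lambda>a. \<mu> a *\<^sub>R a"] by (auto simp: \<mu>_def)
    have neg: "\<exists>a\<in>S. \<nu> a < 0" if "sum \<nu> S = 0" "\<exists>v\<in>S. \<nu> v \<noteq> 0" for \<nu> :: "'a \<Rightarrow> real"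
    proof (rule ccontr)
      assume "\<not> (\<exists>a\<in>S. \<nu> a < 0)"
      then have "\<And>a. a \<in> S \<Longrightarrow> 0 \<le> \<nu> a" by (meson not_le)
      then have "\<forall>a\<in>S. \<nu> a = 0" using sum_nonneg_eq_0_iff[OF S(2)] that(1) by blast
      then show False using that(2) by blast
    qed
    obtain t where t: "0 < t" "\<And>a. a \<in> S \<Longrightarrow> 0 \<le> w a + t * \<mu> a" "\<exists>a\<in>S. w a + t * \<mu> a = 0"
      using weights_shrink[OF S(2), of w \<mu>] pos neg[OF \<mu>(4,3)] by blast
    have "\<exists>a\<in>S. - \<mu> a < 0"
      using neg[of "\<lambda>a. - \<mu> a"] \<mu>(3,4) by (simp add: sum_negf)
    then obtain s where s: "0 < s" "\<And>a. a \<in> S \<Longrightarrow> 0 \<le> w a + s * - \<mu> a" "\<exists>a\<in>S. w a + s * - \<mu> a = 0"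
      using weights_shrink[OF S(2), of w "\<lambda>a. - \<mu> a"] pos by blast
    \<comment> \<open>The factor \<open>k\<close> is there because \<open>w\<close> is a convex combination of the two shifted weights, whereas
      the hypothesis \<open>add\<close> speaks of plain sums.\<close>
    have smaller: "Q (\<lambda>a. k * (w a + r * \<mu> a))"
      if "0 < k" "\<And>a. a \<in> S \<Longrightarrow> 0 \<le> w a + r * \<mu> a" "\<exists>a\<in>S. w a + r * \<mu> a = 0" for k r
    proof (rule less.hyps)
      have out: "w a + r * \<mu> a = 0" if "a \<in> A - S" for a
        using that zero by (simp add: \<mu>_def)
      show "0 \<le> k * (w a + r * \<mu> a)" if "a \<in> A" for a
        using out[of a] \<open>0 < k\<close> that(1) \<open>\<And>a. a \<in> S \<Longrightarrow> 0 \<le> w a + r * \<mu> a\<close>[of a]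
        by (cases "a \<in> S") simp_all
      have "{a \<in> A. 0 < k * (w a + r * \<mu> a)} \<subset> S"
        using out that(1,3) S(1) by force
      then show "card {a \<in> A. 0 < k * (w a + r * \<mu> a)} < card {a \<in> A. 0 < w a}"
        using psubset_card_mono[OF S(2)] unfolding S_def by blast
      have "(\<Sum>a\<in>A. (w a + r * \<mu> a) *\<^sub>R a) = (\<Sum>a\<in>A. w a *\<^sub>R a) + r *\<^sub>R (\<Sum>a\<in>A. \<mu> a *\<^sub>R a)"
        by (simp add: scaleR_add_left sum.distrib scaleR_sum_right)
      also have "\<dots> = sum w A *\<^sub>R x"
        by (simp add: less.prems(2) \<mu>(2))
      also have "sum w A = (\<Sum>a\<in>A. w a + r * \<mu> a)"
        by (simp add: sum.distrib \<mu>(1) flip: sum_distrib_left)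
      finally have "(\<Sum>a\<in>A. (w a + r * \<mu> a) *\<^sub>R a) = (\<Sum>a\<in>A. w a + r * \<mu> a) *\<^sub>R x" .
      then have "k *\<^sub>R (\<Sum>a\<in>A. (w a + r * \<mu> a) *\<^sub>R a) = k *\<^sub>R (\<Sum>a\<in>A. w a + r * \<mu> a) *\<^sub>R x"
        by simp
      then show "(\<Sum>a\<in>A. (k * (w a + r * \<mu> a)) *\<^sub>R a) = (\<Sum>a\<in>A. k * (w a + r * \<mu> a)) *\<^sub>R x"
        by (simp add: scaleR_sum_right sum_distrib_left)
    qed
    have "Q (\<lambda>a. s / (s + t) * (w a + t * \<mu> a) + t / (s + t) * (w a + (- s) * \<mu> a))"
      using s t by (intro add smaller) auto
    also have "(\<lambda>a. s / (s + t) * (w a + t * \<mu> a) + t / (s + t) * (w a + (- s) * \<mu> a)) = w"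
    proof
      fix a
      have "s * (w a + t * \<mu> a) + t * (w a + (- s) * \<mu> a) = (s + t) * w a"
        by (simp add: algebra_simps)
      then show "s / (s + t) * (w a + t * \<mu> a) + t / (s + t) * (w a + (- s) * \<mu> a) = w a"
        using s(1) t(1) by (simp flip: add_divide_distrib)
    qed
    finally show ?thesis .
  qed
qed

text \<open>
  If \<open>S\<close> did not span the affine hull of \<open>P\<close>, extending \<open>S\<close> to an affine basis in \<open>A\<close> and dropping a
  new point would give a determined hyperplane through \<open>x\<close>, although \<open>B\<close>, and with it \<open>x\<close>, lies strictly
  on one side. The zero set of a barycentric coordinate of the simplex is the hyperplane through the
  opposite facet, so the coordinate has the same strict sign on \<open>B\<close> as at \<open>x\<close>, where it is not negative.
\<close>

lemma chamber_subset_simplex: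
  fixes P A S B :: "'a::euclidean_space set"
  assumes A: "affine hull A = affine hull P"
    and S: "S \<subseteq> A" "\<not> affine_dependent S"
    and B: "B \<subseteq> affine hull P"
    and x: "x \<in> convex hull B" "x \<in> convex hull S"
    and side: "\<And>H. H \<in> determined_hyperplanes P A \<Longrightarrow> same_side (affine hull P) H B"
  shows "B \<subseteq> rel_interior (convex hull S)"
proof -
  have finS: "finite S" using S(2) by (rule aff_independent_finite)
  have S0: "S \<noteq> {}" using x(2) by auto
  have facet: "affine hull (T - {a}) \<in> determined_hyperplanes P A"
    if T: "T \<subseteq> A" "\<not> affine_dependent T" "affine hull T = affine hull P" "a \<in> T" "T - {a} \<noteq> {}"
    for T a
  proof -
    have "\<not> affine_dependent (T - {a})" using T(2) by (rule affine_independent_Diff)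
    moreover have "aff_dim (affine hull (T - {a})) = aff_dim P - 1"
    proof -
      have "finite T" using T(2) by (rule aff_independent_finite)
      then have "int (card T) = int (card (T - {a})) + 1"
        using T(4) by (metis Suc_eq_plus1 card_Suc_Diff1 of_nat_1 of_nat_add)
      then show ?thesis
        using aff_dim_affine_independent[OF T(2)] aff_dim_affine_independent[OF calculation]
          aff_dim_affine_hull2[OF T(3)] by simp
    qed
    moreover have "affine hull (T - {a}) \<subseteq> affine hull P"
      using hull_mono[of "T - {a}" T affine] T(3) by auto
    ultimately show ?thesis
      unfolding determined_hyperplanes_def using T by blast
  qed
  have side_ineq: "c < h \<bullet> x" if "B \<subseteq> {z \<in> affine hull P. c < h \<bullet> z}" for h c
    using hull_minimal[of B "{z. c < h \<bullet> z}" convex] that x(1) convex_halfspace_gt[of c h] by auto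
  have full: "affine hull S = affine hull P"
  proof (rule ccontr)
    assume ne: "affine hull S \<noteq> affine hull P"
    obtain T where T: "\<not> affine_dependent T" "S \<subseteq> T" "T \<subseteq> A" "affine hull T = affine hull A"
      using extend_to_affine_basis_nonempty[OF S(2,1) S0] by auto
    then have "T \<noteq> S" using ne A by auto
    then obtain a where a: "a \<in> T" "a \<notin> S" using T(2) by auto
    have "S \<subseteq> T - {a}" using a T by auto
    then have "x \<in> affine hull (T - {a})"
      using x(2) convex_hull_subset_affine_hull[of S] hull_mono[of S "T - {a}" affine] by auto
    moreover have "same_side (affine hull P) (affine hull (T - {a})) B"
      by (intro side facet) (use T A a S0 \<open>S \<subseteq> T - {a}\<close> in auto)
    ultimately show False
      using side_ineq unfolding same_side_def by fastforce
  qed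
  obtain v where v: "\<And>a. a \<in> S \<Longrightarrow> 0 \<le> v a" "sum v S = 1" "(\<Sum>a\<in>S. v a *\<^sub>R a) = x"
    using x(2) unfolding convex_hull_finite[OF finS] by auto
  show ?thesis
  proof
    fix b assume b: "b \<in> B"
    then have "b \<in> affine hull S" using B full by auto
    then obtain u where u: "sum u S = 1" "(\<Sum>a\<in>S. u a *\<^sub>R a) = b"
      unfolding affine_hull_finite[OF finS] by auto
    have "0 < u a" if a: "a \<in> S" for a
    proof (cases "S - {a} = {}")
      case True
      then have "S = {a}" using a by auto
      then show ?thesis using u(1) by simp
    next
      case False
      obtain h c where H: "affine hull (S - {a}) = {z \<in> affine hull P. h \<bullet> z = c}"
          and above: "B \<subseteq> {z \<in> affine hull P. c < h \<bullet> z}"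
        using side[OF facet[OF S full a False]] unfolding same_side_def by auto
      have on: "h \<bullet> z = c" if "z \<in> S - {a}" for z
        using hull_inc[OF that, of affine] H by auto
      \<comment> \<open>The equation of the facet opposite \<open>a\<close> is a multiple of the barycentric coordinate at \<open>a\<close>.\<close>
      have coord: "h \<bullet> z - c = r a * (h \<bullet> a - c)"
        if "sum r S = 1" "(\<Sum>a\<in>S. r a *\<^sub>R a) = z" for r z
      proof -
        have "h \<bullet> z - c = (\<Sum>y\<in>S. r y * (h \<bullet> y - c))"
          using that by (auto simp: inner_sum_right right_diff_distrib sum_subtractf
              simp flip: sum_distrib_right)
        also have "\<dots> = r a * (h \<bullet> a - c)"
          using on by (subst sum.remove[OF finS a]) simp
        finally show ?thesis .
      qed
      have "0 < v a * (h \<bullet> a - c)"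
        using coord[OF v(2,3)] side_ineq[OF above] by simp
      then have "0 < h \<bullet> a - c"
        using v(1)[OF a] by (simp add: zero_less_mult_iff)
      moreover have "0 < u a * (h \<bullet> a - c)"
        using coord[OF u] above b by auto
      ultimately show ?thesis by (simp add: zero_less_mult_iff)
    qed
    then show "b \<in> rel_interior (convex hull S)"
      unfolding rel_interior_convex_hull_explicit[OF S(2)] using u by auto
  qed
qed

section \<open>A critical point of a ratio of exponential sums\<close>

text \<open>
  The point at distance \<open>\<delta>\<close> from \<open>b\<close> in the direction \<open>y\<close> still lies in the hull, and a linear form on
  the hull is bounded by its values on \<open>A\<close>. The gap \<open>\<delta> * norm y\<close> makes the ratio below coercive.
\<close>

lemma rel_interior_hull_inner_gap:
  fixes A :: "'a::euclidean_space set"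
  assumes "b \<in> rel_interior (convex hull A)" "p \<in> affine hull A"
  obtains \<delta> where "0 < \<delta>"
    "\<And>y. y \<in> (\<lambda>x. x - p) ` (affine hull A) \<Longrightarrow> \<exists>a\<in>A. b \<bullet> y + \<delta> * norm y \<le> a \<bullet> y"
proof -
  let ?L = "(\<lambda>x. x - p) ` (affine hull A)"
  obtain \<delta> where \<delta>: "0 < \<delta>" "cball b \<delta> \<inter> affine hull A \<subseteq> convex hull A"
    and b: "b \<in> convex hull A"
    using assms(1) unfolding mem_rel_interior_cball affine_hull_convex_hull by auto
  have L: "subspace ?L"
    using assms(2) by (intro affine_diffs_subspace_subtract) auto
  show thesis
  proof (rule that[OF \<delta>(1)], rule ccontr)
    fix y assume y: "y \<in> ?L" and *: "\<not> (\<exists>a\<in>A. b \<bullet> y + \<delta> * norm y \<le> a \<bullet> y)"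
    let ?q = "b + (\<delta> / norm y) *\<^sub>R y"
    have "b - p \<in> ?L"
      using b convex_hull_subset_affine_hull by blast
    then have "(b - p) + (\<delta> / norm y) *\<^sub>R y \<in> ?L"
      using L y by (intro subspace_add subspace_scale)
    then have "?q \<in> affine hull A" by (auto simp: algebra_simps)
    moreover have "?q \<in> cball b \<delta>" using \<delta>(1) by (simp add: dist_norm)
    ultimately have "?q \<in> convex hull A" using \<delta>(2) by blast
    also have "convex hull A \<subseteq> {z. y \<bullet> z < b \<bullet> y + \<delta> * norm y}"
      using * by (intro hull_minimal convex_halfspace_lt) (auto simp: inner_commute not_le)
    finally have "y \<bullet> ?q < b \<bullet> y + \<delta> * norm y" by simp
    moreover have "y \<bullet> ?q = b \<bullet> y + \<delta> * norm y"
      by (simp add: inner_add_right inner_commute dot_square_norm power2_eq_square)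
    ultimately show False by simp
  qed
qed

text \<open>
  Moving \<open>y\<close> orthogonally to the affine hull of \<open>A\<close> does not change the ratio of the two sums, so that
  the ratio is coercive only on the space \<open>L\<close> of directions of the affine hull. A minimiser \<open>y\<close> over \<open>L\<close>
  suffices: the first equation says that \<open>t\<close> is the minimum and puts the difference \<open>V\<close> of the two sides
  of the second equation into \<open>L\<close>. The first sum minus \<open>t\<close> times the second is minimal at \<open>y\<close> on \<open>L\<close>,
  and its derivative in direction \<open>V\<close> is \<open>V \<bullet> V\<close>.
\<close>

lemma exp_sum_ratio_critical_point:
  fixes A :: "'a::euclidean_space set" and b :: "'j \<Rightarrow> 'a"
  assumes A: "finite A" "\<And>a. a \<in> A \<Longrightarrow> 0 < c a"
    and J: "finite J" "J \<noteq> {}" "\<And>j. j \<in> J \<Longrightarrow> 0 < e j"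
    and b: "\<And>j. j \<in> J \<Longrightarrow> b j \<in> rel_interior (convex hull A)"
  obtains y t where "0 < t"
    "(\<Sum>a\<in>A. c a * exp (a \<bullet> y)) = t * (\<Sum>j\<in>J. e j * exp (b j \<bullet> y))"
    "(\<Sum>a\<in>A. (c a * exp (a \<bullet> y)) *\<^sub>R a) = (\<Sum>j\<in>J. (t * e j * exp (b j \<bullet> y)) *\<^sub>R b j)"
proof -
  obtain j0 where j0: "j0 \<in> J" using J(2) by auto
  define p where "p = b j0"
  have bP: "b j \<in> affine hull A" if "j \<in> J" for j
    using b[OF that] rel_interior_subset convex_hull_subset_affine_hull by blast
  then have p: "p \<in> affine hull A" using j0 by (simp add: p_def)
  have A0: "A \<noteq> {}" using p by auto
  define L where "L = (\<lambda>x. x - p) ` (affine hull A)"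
  have L: "subspace L"
    unfolding L_def using p by (intro affine_diffs_subspace_subtract) auto
  define G where "G y = (\<Sum>a\<in>A. c a * exp (a \<bullet> y))" for y
  define D where "D y = (\<Sum>j\<in>J. e j * exp (b j \<bullet> y))" for y
  have Gpos: "0 < G y" and Dpos: "0 < D y" for y
    unfolding G_def D_def using A A0 J by (auto intro!: sum_pos)
  have "\<forall>j\<in>J. \<exists>\<delta>>0. \<forall>y\<in>L. \<exists>a\<in>A. b j \<bullet> y + \<delta> * norm y \<le> a \<bullet> y"
    using rel_interior_hull_inner_gap[OF b p] unfolding L_def by metis
  then obtain g where g: "\<And>j. j \<in> J \<Longrightarrow> 0 < g j"
      "\<And>j y. j \<in> J \<Longrightarrow> y \<in> L \<Longrightarrow> \<exists>a\<in>A. b j \<bullet> y + g j * norm y \<le> a \<bullet> y"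
    by metis
  define \<delta> where "\<delta> = Min (g ` J)"
  have \<delta>: "0 < \<delta>" "\<And>j. j \<in> J \<Longrightarrow> \<delta> \<le> g j"
    using J g(1) by (auto simp: \<delta>_def)
  define k where "k = Min (c ` A)"
  have k: "0 < k" "\<And>a. a \<in> A \<Longrightarrow> k \<le> c a"
    using A A0 by (auto simp: k_def)
  define \<kappa> where "\<kappa> = k / sum e J"
  have E: "0 < sum e J" using J by (intro sum_pos) auto
  then have \<kappa>: "0 < \<kappa>" using k by (simp add: \<kappa>_def)
  have grow: "\<kappa> * (\<delta> * norm y) \<le> G y / D y" if y: "y \<in> L" for y
  proof -
    have bound: "exp (b j \<bullet> y) * (k * exp (\<delta> * norm y)) \<le> G y" if j: "j \<in> J" for j
    proof -
      obtain a where a: "a \<in> A" "b j \<bullet> y + g j * norm y \<le> a \<bullet> y"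
        using g(2)[OF j y] by auto
      have "b j \<bullet> y + \<delta> * norm y \<le> a \<bullet> y"
        using a(2) mult_right_mono[OF \<delta>(2)[OF j], of "norm y"] by simp
      then have "k * exp (b j \<bullet> y + \<delta> * norm y) \<le> c a * exp (a \<bullet> y)"
        using k a A(2)[OF a(1)] by (intro mult_mono) auto
      also have "\<dots> \<le> G y"
        unfolding G_def using A(2) by (intro member_le_sum a A) (auto intro: less_imp_le)
      finally show ?thesis by (simp add: exp_add algebra_simps)
    qed
    have "D y * (k * exp (\<delta> * norm y)) = (\<Sum>j\<in>J. e j * (exp (b j \<bullet> y) * (k * exp (\<delta> * norm y))))"
      by (simp add: D_def sum_distrib_right mult.assoc)
    also have "\<dots> \<le> (\<Sum>j\<in>J. e j * G y)"
      using bound J(3) by (intro sum_mono mult_left_mono) (auto intro: less_imp_le)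
    also have "\<dots> = sum e J * G y" by (simp add: sum_distrib_right)
    finally have "\<kappa> * exp (\<delta> * norm y) \<le> G y / D y"
      using E Dpos[of y] by (simp add: \<kappa>_def field_simps)
    moreover have "\<delta> * norm y \<le> exp (\<delta> * norm y)"
      using exp_ge_add_one_self[of "\<delta> * norm y"] by linarith
    ultimately show ?thesis
      using \<kappa> by (meson mult_left_mono order_trans less_imp_le)
  qed
  \<comment> \<open>Outside the ball of radius \<open>r\<close> the ratio exceeds its value at \<open>0\<close>.\<close>
  define r where "r = G 0 / D 0 / (\<kappa> * \<delta>)"
  have "0 \<le> r" using Gpos[of 0] Dpos[of 0] \<kappa> \<delta>(1) by (simp add: r_def)
  have "compact (L \<inter> cball 0 r)"
    using closed_subspace[OF L] by (intro closed_Int_compact) auto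
  moreover have "0 \<in> L \<inter> cball 0 r"
    using subspace_0[OF L] \<open>0 \<le> r\<close> by auto
  moreover have "continuous_on (L \<inter> cball 0 r) (\<lambda>y. G y / D y)"
  proof (intro continuous_on_divide ballI)
    show "continuous_on (L \<inter> cball 0 r) G" "continuous_on (L \<inter> cball 0 r) D"
      unfolding G_def D_def by (intro continuous_intros)+
  qed (use Dpos in \<open>simp add: less_imp_neq[symmetric]\<close>)
  ultimately obtain y where y: "y \<in> L \<inter> cball 0 r"
      and min_ball: "\<And>z. z \<in> L \<inter> cball 0 r \<Longrightarrow> G y / D y \<le> G z / D z"
    using continuous_attains_inf[of "L \<inter> cball 0 r" "\<lambda>y. G y / D y"] by blast
  define t where "t = G y / D y"
  have t: "0 < t" using Gpos Dpos by (simp add: t_def)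
  have min: "t \<le> G z / D z" if z: "z \<in> L" for z
  proof (cases "norm z \<le> r")
    case True
    then show ?thesis using min_ball z by (simp add: t_def)
  next
    case False
    have "t \<le> G 0 / D 0" using min_ball \<open>0 \<in> L \<inter> cball 0 r\<close> by (simp add: t_def)
    also have "\<dots> = \<kappa> * (\<delta> * r)" using \<kappa> \<delta>(1) by (simp add: r_def)
    also have "\<dots> \<le> \<kappa> * (\<delta> * norm z)" using \<kappa> \<delta>(1) False by (intro mult_left_mono) auto
    also have "\<dots> \<le> G z / D z" by (rule grow[OF z])
    finally show ?thesis .
  qed
  have GD: "G y = t * D y" using Dpos[of y] by (simp add: t_def)
  define V where
    "V = (\<Sum>a\<in>A. (c a * exp (a \<bullet> y)) *\<^sub>R a) - (\<Sum>j\<in>J. (t * e j * exp (b j \<bullet> y)) *\<^sub>R b j)"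
  have "V = (\<Sum>a\<in>A. (c a * exp (a \<bullet> y)) *\<^sub>R (a - p)) - (\<Sum>j\<in>J. (t * e j * exp (b j \<bullet> y)) *\<^sub>R (b j - p))"
    (is "_ = ?V1 - ?V2")
  proof -
    have "(\<Sum>a\<in>A. (c a * exp (a \<bullet> y)) *\<^sub>R p) = G y *\<^sub>R p"
      by (simp add: G_def scaleR_sum_left)
    moreover have "(\<Sum>j\<in>J. (t * e j * exp (b j \<bullet> y)) *\<^sub>R p) = G y *\<^sub>R p"
      by (simp add: GD D_def scaleR_sum_left[symmetric] sum_distrib_left mult.assoc)
    ultimately show ?thesis
      by (simp add: V_def scaleR_diff_right sum_subtractf)
  qed
  moreover have "?V1 \<in> L"
    using hull_inc[of _ A affine]
    by (intro subspace_sum[OF L] subspace_scale[OF L]) (auto simp: L_def)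
  moreover have "?V2 \<in> L"
    using bP by (intro subspace_sum[OF L] subspace_scale[OF L]) (auto simp: L_def)
  ultimately have V: "V \<in> L"
    using subspace_diff[OF L] by simp
  let ?f = "\<lambda>s. G (y + s *\<^sub>R V) - t * D (y + s *\<^sub>R V)"
  have "(?f has_real_derivative V \<bullet> V) (at 0)"
  proof -
    have "(?f has_real_derivative
        (\<Sum>a\<in>A. c a * exp (a \<bullet> y) * (a \<bullet> V)) - t * (\<Sum>j\<in>J. e j * exp (b j \<bullet> y) * (b j \<bullet> V))) (at 0)"
      unfolding G_def D_def inner_add_right inner_scaleR_right
      by (auto intro!: derivative_eq_intros simp: mult_ac)
    moreover have "V \<bullet> V =
        (\<Sum>a\<in>A. c a * exp (a \<bullet> y) * (a \<bullet> V)) - t * (\<Sum>j\<in>J. e j * exp (b j \<bullet> y) * (b j \<bullet> V))"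
      by (subst V_def) (simp add: inner_diff_left inner_sum_left sum_distrib_left mult.assoc)
    ultimately show ?thesis by simp
  qed
  moreover have "\<forall>s. \<bar>0 - s\<bar> < 1 \<longrightarrow> ?f 0 \<le> ?f s"
  proof (intro allI impI)
    fix s :: real
    have "y + s *\<^sub>R V \<in> L"
      using L y V by (auto intro: subspace_add subspace_scale)
    from min[OF this] show "?f 0 \<le> ?f s"
      using Dpos[of "y + s *\<^sub>R V"] GD by (simp add: field_simps)
  qed
  ultimately have "V \<bullet> V = 0"
    using DERIV_local_min[of ?f "V \<bullet> V" 0 1] by simp
  then have "V = 0" by simp
  then show thesis
    using that[of t y] t GD unfolding V_def G_def D_def by simp
qed

section \<open>From a critical point to circuit polynomials\<close>

text \<open>
  The claim is additive in the weights when the inner part is scaled in proportion to their total mass,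
  so \<open>weights_induct\<close> reduces it to weights \<open>w\<close> supported on the vertices \<open>T\<close> of a simplex around
  \<open>x\<close>. There, barycentric coordinates are unique: \<open>w\<close> equals the sum over \<open>j\<close> of the coordinates of
  \<open>rvec (\<beta> j)\<close> scaled in proportion to \<open>e j\<close>, and each summand balances one inner term.
\<close>

lemma SONC_if_balanced:
  fixes A :: "(nat ^ 'n::finite) set" and w :: "real ^ 'n \<Rightarrow> real" and y :: "real ^ 'n"
  assumes A: "finite A" "\<And>a. a \<in> A \<Longrightarrow> even_exp a" "\<And>p. p \<in> rvec ` A \<Longrightarrow> 0 \<le> w p"
    and J: "finite J" "J \<noteq> {}"
    and e: "\<And>j. j \<in> J \<Longrightarrow> 0 < e j" "\<And>j. j \<in> J \<Longrightarrow> \<bar>d j\<bar> * exp (rvec (\<beta> j) \<bullet> y) \<le> e j"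
    and mass: "sum w (rvec ` A) = sum e J"
    and mean: "(\<Sum>p\<in>rvec ` A. w p *\<^sub>R p) = sum e J *\<^sub>R x" "(\<Sum>j\<in>J. e j *\<^sub>R rvec (\<beta> j)) = sum e J *\<^sub>R x"
    and chamber: "\<And>T j. T \<subseteq> rvec ` A \<Longrightarrow> \<not> affine_dependent T \<Longrightarrow> x \<in> convex hull T \<Longrightarrow> j \<in> J \<Longrightarrow>
      rvec (\<beta> j) \<in> rel_interior (convex hull T)"
  shows "(\<Sum>a\<in>A. Poly_Mapping.single a (w (rvec a) * exp (- (rvec a \<bullet> y))))
    - (\<Sum>j\<in>J. Poly_Mapping.single (\<beta> j) (d j)) \<in> SONC"
proof -
  define E where "E = sum e J"
  have E: "0 < E" unfolding E_def using J e(1) by (intro sum_pos) auto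
  define F where "F w = (\<Sum>a\<in>A. Poly_Mapping.single a (w (rvec a) * exp (- (rvec a \<bullet> y))))
    - (\<Sum>j\<in>J. Poly_Mapping.single (\<beta> j) (sum w (rvec ` A) / E * d j))" for w
  have "F w \<in> SONC"
  proof (rule weights_induct[where Q = "\<lambda>w. F w \<in> SONC" and A = "rvec ` A" and x = x])
    fix w T
    assume T: "T \<subseteq> rvec ` A" "\<not> affine_dependent T"
      and pos: "\<And>p. p \<in> T \<Longrightarrow> 0 < w p" and zero: "\<And>p. p \<in> rvec ` A - T \<Longrightarrow> w p = 0"
      and meanT: "(\<Sum>p\<in>T. w p *\<^sub>R p) = sum w T *\<^sub>R x"
    have finT: "finite T" using T(2) by (rule aff_independent_finite)
    define W where "W = sum w T"
    have W: "sum w (rvec ` A) = W"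
      unfolding W_def using zero by (intro sum.mono_neutral_right finite_imageI A(1) T(1)) auto
    define S where "S = {a \<in> A. rvec a \<in> T}"
    have S: "S \<subseteq> A" "finite S" "rvec ` S = T"
      using A(1) T(1) by (auto simp: S_def)
    show "F w \<in> SONC"
    proof (cases "T = {}")
      case True
      then have "W = 0" "\<And>a. a \<in> A \<Longrightarrow> w (rvec a) = 0"
        using zero by (auto simp: W_def)
      then show ?thesis by (simp add: F_def W SONC_0)
    next
      case False
      have Wpos: "0 < W" unfolding W_def using finT False pos by (intro sum_pos) auto
      have "x \<in> convex hull T"
        unfolding convex_hull_finite[OF finT]
      proof (intro CollectI exI conjI ballI)
        show "0 \<le> w p / W" if "p \<in> T" for p using pos[OF that] Wpos by simp
        show "(\<Sum>p\<in>T. w p / W) = 1"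
          using Wpos by (simp add: W_def flip: sum_divide_distrib)
        have "(\<Sum>p\<in>T. (w p / W) *\<^sub>R p) = (1 / W) *\<^sub>R (\<Sum>p\<in>T. w p *\<^sub>R p)"
          by (simp add: scaleR_sum_right)
        then show "(\<Sum>p\<in>T. (w p / W) *\<^sub>R p) = x"
          using Wpos meanT by (simp add: W_def)
      qed
      then have "\<forall>j\<in>J. \<exists>u. (\<forall>p\<in>T. 0 < u p) \<and> sum u T = 1 \<and> (\<Sum>p\<in>T. u p *\<^sub>R p) = rvec (\<beta> j)"
        using chamber[OF T] unfolding rel_interior_convex_hull_explicit[OF T(2)] by blast
      then obtain u where u: "\<And>j p. j \<in> J \<Longrightarrow> p \<in> T \<Longrightarrow> 0 < u j p"
          "\<And>j. j \<in> J \<Longrightarrow> sum (u j) T = 1" "\<And>j. j \<in> J \<Longrightarrow> (\<Sum>p\<in>T. u j p *\<^sub>R p) = rvec (\<beta> j)"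
        by metis
      define k where "k j = W / E * e j" for j
      have kpos: "0 < k j" if "j \<in> J" for j
        using that e(1) E Wpos by (simp add: k_def)
      have split: "w p = (\<Sum>j\<in>J. k j * u j p)" if "p \<in> T" for p
      proof -
        \<comment> \<open>If \<open>\<nu>\<close> were nonzero, it would be an affine dependence of \<open>T\<close>.\<close>
        define \<nu> where "\<nu> p = w p - (\<Sum>j\<in>J. k j * u j p)" for p
        have "sum \<nu> T = W - (\<Sum>j\<in>J. k j * sum (u j) T)"
          unfolding \<nu>_def sum_subtractf W_def sum_distrib_left by (subst sum.swap) simp
        also have "(\<Sum>j\<in>J. k j * sum (u j) T) = (\<Sum>j\<in>J. W / E * e j)"
          using u(2) by (simp add: k_def)
        also have "\<dots> = W / E * sum e J" by (rule sum_distrib_left[symmetric])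
        also have "W - \<dots> = 0" using E by (simp add: E_def)
        finally have "sum \<nu> T = 0" .
        moreover have "(\<Sum>p\<in>T. \<nu> p *\<^sub>R p) = 0"
        proof -
          have "(\<Sum>p\<in>T. \<nu> p *\<^sub>R p) = W *\<^sub>R x - (\<Sum>p\<in>T. \<Sum>j\<in>J. k j *\<^sub>R u j p *\<^sub>R p)"
            using meanT
            by (simp add: \<nu>_def scaleR_diff_left sum_subtractf W_def scaleR_sum_left)
          also have "(\<Sum>p\<in>T. \<Sum>j\<in>J. k j *\<^sub>R u j p *\<^sub>R p) = (\<Sum>j\<in>J. k j *\<^sub>R (\<Sum>p\<in>T. u j p *\<^sub>R p))"
            unfolding scaleR_sum_right by (rule sum.swap)
          also have "\<dots> = (\<Sum>j\<in>J. (W / E) *\<^sub>R e j *\<^sub>R rvec (\<beta> j))"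
            using u(3) by (simp add: k_def)
          also have "\<dots> = (W / E) *\<^sub>R (\<Sum>j\<in>J. e j *\<^sub>R rvec (\<beta> j))"
            by (rule scaleR_sum_right[symmetric])
          also have "\<dots> = W *\<^sub>R x"
            using E by (simp add: mean(2) E_def)
          finally show ?thesis by simp
        qed
        ultimately have "\<nu> p = 0"
          using T(2) that unfolding affine_dependent_explicit_finite[OF finT] by blast
        then show ?thesis by (simp add: \<nu>_def)
      qed
      have "(\<Sum>a\<in>A. Poly_Mapping.single a (w (rvec a) * exp (- (rvec a \<bullet> y))))
          = (\<Sum>a\<in>S. Poly_Mapping.single a (w (rvec a) * exp (- (rvec a \<bullet> y))))"
        using A(1) S(1) zero by (intro sum.mono_neutral_right) (auto simp: S_def)
      also have "\<dots> = (\<Sum>a\<in>S. \<Sum>j\<in>J. Poly_Mapping.single a (k j * u j (rvec a) * exp (- (rvec a \<bullet> y))))"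
        by (intro sum.cong) (auto simp: S_def split sum_distrib_right simp flip: single_sum)
      also have "\<dots> = (\<Sum>j\<in>J. \<Sum>a\<in>S. Poly_Mapping.single a (k j * u j (rvec a) * exp (- (rvec a \<bullet> y))))"
        by (rule sum.swap)
      finally have "F w = (\<Sum>j\<in>J. (\<Sum>a\<in>S. Poly_Mapping.single a (k j * u j (rvec a) * exp (- (rvec a \<bullet> y))))
          - Poly_Mapping.single (\<beta> j) (W / E * d j))"
        by (simp add: F_def W sum_subtractf)
      also have "\<dots> \<in> SONC"
      proof (intro SONC_sum SONC_nonneg_circuit nonneg_circuit_if_am_gm)
        fix j assume j: "j \<in> J"
        show "finite S" "\<not> affine_dependent (rvec ` S)" using S T(2) by auto
        show "even_exp a" if "a \<in> S" for a using that S(1) A(2) by auto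
        show "0 < u j (rvec a)" if "a \<in> S" for a using that u(1)[OF j] by (auto simp: S_def)
        show "(\<Sum>a\<in>S. u j (rvec a)) = 1" "(\<Sum>a\<in>S. u j (rvec a) *\<^sub>R rvec a) = rvec (\<beta> j)"
          using u(2,3)[OF j] unfolding S(3)[symmetric]
          by (simp_all add: sum.reindex inj_on_subset[OF inj_rvec])
        show "0 < k j" by (rule kpos[OF j])
        have "\<bar>d j\<bar> \<le> e j * exp (- (rvec (\<beta> j) \<bullet> y))"
          using e(2)[OF j] by (simp add: exp_minus field_simps)
        then have "W / E * \<bar>d j\<bar> \<le> W / E * (e j * exp (- (rvec (\<beta> j) \<bullet> y)))"
          using Wpos E by (intro mult_left_mono) auto
        then show "\<bar>W / E * d j\<bar> \<le> k j * exp (- (rvec (\<beta> j) \<bullet> y))"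
          using Wpos E by (simp add: k_def abs_mult mult.assoc)
      qed
      finally show ?thesis .
    qed
  next
    fix w1 w2 assume "F w1 \<in> SONC" "F w2 \<in> SONC"
    moreover have "F (\<lambda>a. w1 a + w2 a) = F w1 + F w2"
      by (simp add: F_def distrib_right add_divide_distrib single_add sum.distrib)
    ultimately show "F (\<lambda>a. w1 a + w2 a) \<in> SONC" using SONC_add by simp
  qed (use A(1,3) mean(1) mass in auto)
  then show ?thesis using E by (simp add: F_def mass E_def)
qed

section \<open>Signs and Newton polytope of the given form\<close>

text \<open>
  Only the signs of \<open>v\<close> matter: evaluate \<open>f\<close> at the point with these signs and with absolute values
  \<open>exp (y $ i)\<close>.
\<close>

lemma PSD_imp_nonneg_exp_sum:
  assumes "f \<in> PSD"
    and f: "f = (\<Sum>a\<in>A. Poly_Mapping.single a (C a)) - (\<Sum>j\<in>J. Poly_Mapping.single (\<beta> j) (d j))"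
    and even: "\<And>a. a \<in> A \<Longrightarrow> even_exp a"
    and v: "\<And>i. v $ i \<noteq> 0" "\<And>j. j \<in> J \<Longrightarrow> 0 < d j * mono_eval v (\<beta> j)"
  shows "(\<Sum>j\<in>J. \<bar>d j\<bar> * exp (rvec (\<beta> j) \<bullet> y)) \<le> (\<Sum>a\<in>A. C a * exp (rvec a \<bullet> y))"
proof -
  define r where "r = (\<chi> i. exp (y $ i) / \<bar>v $ i\<bar>)"
  define x where "x = (\<chi> i. v $ i * r $ i)"
  have x: "x $ i \<noteq> 0" for i using v(1) by (simp add: x_def r_def)
  have y: "(\<chi> i. ln \<bar>x $ i\<bar>) = y"
    using v(1) by (simp add: x_def r_def abs_mult vec_eq_iff)
  have term\<beta>: "d j * mono_eval x (\<beta> j) = \<bar>d j\<bar> * exp (rvec (\<beta> j) \<bullet> y)" if "j \<in> J" for j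
  proof -
    have "mono_eval x (\<beta> j) = mono_eval v (\<beta> j) * mono_eval r (\<beta> j)"
      by (simp add: mono_eval_def x_def power_mult_distrib prod.distrib)
    moreover have "0 < mono_eval r (\<beta> j)"
      using v(1) by (auto simp: mono_eval_def r_def intro!: prod_pos zero_less_power)
    ultimately have "0 < d j * mono_eval x (\<beta> j)"
      using mult_pos_pos[OF v(2)[OF that]] by (simp add: mult.assoc)
    then have "d j * mono_eval x (\<beta> j) = \<bar>d j\<bar> * \<bar>mono_eval x (\<beta> j)\<bar>"
      by (simp flip: abs_mult)
    then show ?thesis by (simp add: abs_mono_eval_eq_exp[OF x] y)
  qed
  have "0 \<le> poly_eval f x" using assms(1) by (simp add: PSD_def)
  also have "poly_eval f x = (\<Sum>a\<in>A. C a * mono_eval x a) - (\<Sum>j\<in>J. d j * mono_eval x (\<beta> j))"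
    by (simp add: f poly_eval_diff poly_eval_sum)
  finally show ?thesis
    using even by (simp add: term\<beta> mono_eval_even_eq_exp x y)
qed

text \<open>
  Terms may cancel when some \<open>\<beta> j\<close> equals an element of \<open>A\<close>, but then that element lies in the Newton
  polytope by \<open>inner\<close>. Conversely a vertex is never a relative interior point, unless the polytope
  is a single point, and so comes from \<open>A\<close>.
\<close>

lemma New_eq_convex_hull_outer:
  assumes A: "finite A" "A \<noteq> {}" and J: "finite J" and C: "\<And>a. a \<in> A \<Longrightarrow> C a \<noteq> 0"
    and f: "f = (\<Sum>a\<in>A. Poly_Mapping.single a (C a)) - (\<Sum>j\<in>J. Poly_Mapping.single (\<beta> j) (d j))"
    and inner: "\<And>j. j \<in> J \<Longrightarrow> rvec (\<beta> j) \<in> rel_interior (New f)"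
  shows "New f = convex hull (rvec ` A)"
proof
  have lookup: "Poly_Mapping.lookup f a
      = (if a \<in> A then C a else 0) - (\<Sum>j\<in>J. if \<beta> j = a then d j else 0)" for a
    by (simp add: f lookup_minus lookup_sum lookup_single when_def A(1))
  have "rvec a \<in> New f" if a: "a \<in> A" for a
  proof (cases "\<exists>j\<in>J. \<beta> j = a")
    case True
    then show ?thesis using inner rel_interior_subset by blast
  next
    case False
    then have "(\<Sum>j\<in>J. if \<beta> j = a then d j else 0) = 0"
      by (intro sum.neutral) auto
    then have "a \<in> Poly_Mapping.keys f"
      using C[OF a] a by (simp add: in_keys_iff lookup)
    then show ?thesis unfolding New_def by (intro hull_inc) auto
  qed
  then show sub: "convex hull (rvec ` A) \<subseteq> New f"
    by (intro hull_minimal) (auto simp: New_def)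
  show "New f \<subseteq> convex hull (rvec ` A)"
  proof (cases "\<exists>p. New f = {p}")
    case True
    then obtain p where p: "New f = {p}" by auto
    have "convex hull (rvec ` A) \<noteq> {}" using A(2) by simp
    then show ?thesis using sub unfolding p by (auto simp: subset_singleton_iff)
  next
    case False
    have "finite (rvec ` Poly_Mapping.keys f)" by simp
    then have "compact (New f)" "convex (New f)"
      unfolding New_def by (auto intro: finite_imp_compact_convex_hull)
    then have "New f = convex hull {p. p extreme_point_of New f}"
      by (rule Krein_Milman_Minkowski)
    also have "\<dots> \<subseteq> convex hull (rvec ` A)"
    proof (intro hull_mono subsetI)
      fix p assume "p \<in> {p. p extreme_point_of New f}"
      then have p: "p extreme_point_of New f" by simp
      then obtain a where a: "a \<in> Poly_Mapping.keys f" "p = rvec a"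
        using extreme_point_of_convex_hull unfolding New_def by blast
      have "p \<notin> rel_interior (New f)"
        using False by (intro extreme_point_not_in_REL_INTERIOR[OF p]) auto
      then have "\<beta> j \<noteq> a" if "j \<in> J" for j
        using inner[OF that] a(2) by auto
      then have "(\<Sum>j\<in>J. if \<beta> j = a then d j else 0) = 0"
        by (intro sum.neutral) auto
      then show "p \<in> rvec ` A"
        using a by (auto simp: in_keys_iff lookup split: if_splits)
    qed
    finally show ?thesis .
  qed
qed

section \<open>Nonnegative polynomials with inner exponents in one chamber\<close>

text \<open>
  With the critical point \<open>y\<close> as base point, the weights at \<open>y\<close> of the outer terms and those of the inner
  terms, the latter magnified by the minimal ratio \<open>t\<close>, are balanced. Nonnegativity of \<open>f\<close> gives
  \<open>1 \<le> t\<close>, which is what AM-GM for the original inner coefficients needs.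
\<close>

lemma PSD_imp_SONC_one_chamber:
  fixes f :: "'n::finite rpoly"
  assumes A: "finite A" "\<And>a. a \<in> A \<Longrightarrow> even_exp a" "\<And>a. a \<in> A \<Longrightarrow> 0 < C a" and J: "finite J"
    and f: "f = (\<Sum>a\<in>A. Poly_Mapping.single a (C a)) - (\<Sum>j\<in>J. Poly_Mapping.single (\<beta> j) (d j))"
    and inner: "\<And>j. j \<in> J \<Longrightarrow> rvec (\<beta> j) \<in> rel_interior (New f)"
    and side: "\<And>H. H \<in> determined_hyperplanes (New f) (rvec ` A) \<Longrightarrow>
      same_side (affine hull (New f)) H ((\<lambda>j. rvec (\<beta> j)) ` J)"
    and v: "\<And>i. v $ i \<noteq> 0" "\<And>j. j \<in> J \<Longrightarrow> 0 < d j * mono_eval v (\<beta> j)"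
    and psd: "f \<in> PSD"
  shows "f \<in> SONC"
proof (cases "J = {}")
  case True
  then have "f = (\<Sum>a\<in>A. Poly_Mapping.single a (C a))" by (simp add: f)
  also have "\<dots> \<in> SONC"
    using A(2,3) by (intro SONC_sum SONC_nonneg_circuit) (auto simp: nonneg_circuit_poly_def)
  finally show ?thesis .
next
  case False
  note exp_nonneg = PSD_imp_nonneg_exp_sum[OF psd f A(2) v]
  have d: "0 < \<bar>d j\<bar>" if "j \<in> J" for j using v(2)[OF that] by auto
  have Dpos: "0 < (\<Sum>j\<in>J. \<bar>d j\<bar> * exp (rvec (\<beta> j) \<bullet> y))" for y
    using J False d by (intro sum_pos) auto
  \<comment> \<open>Without outer terms \<open>f\<close> would take a negative value.\<close>
  have "A \<noteq> {}" using exp_nonneg[of 0] Dpos[of 0] by auto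
  have New: "New f = convex hull (rvec ` A)"
    using A(3) by (intro New_eq_convex_hull_outer[OF A(1) \<open>A \<noteq> {}\<close> J _ f inner]) force+
  have inv: "inv rvec (rvec a) = a" for a :: "nat ^ 'n" by (simp add: inj_rvec)
  note reindex = sum.reindex[OF inj_on_subset[OF inj_rvec], simplified]
  define c where "c p = C (inv rvec p)" for p
  have cpos: "0 < c p" if "p \<in> rvec ` A" for p using that A(3) by (auto simp: c_def inv)
  obtain y t where t: "0 < t"
    and GD: "(\<Sum>p\<in>rvec ` A. c p * exp (p \<bullet> y)) = t * (\<Sum>j\<in>J. \<bar>d j\<bar> * exp (rvec (\<beta> j) \<bullet> y))"
    and crit: "(\<Sum>p\<in>rvec ` A. (c p * exp (p \<bullet> y)) *\<^sub>R p)
      = (\<Sum>j\<in>J. (t * \<bar>d j\<bar> * exp (rvec (\<beta> j) \<bullet> y)) *\<^sub>R rvec (\<beta> j))"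
    by (rule exp_sum_ratio_critical_point[OF finite_imageI[OF A(1)] cpos J False d inner[unfolded New]])
  have "1 \<le> t"
  proof -
    have "(\<Sum>j\<in>J. \<bar>d j\<bar> * exp (rvec (\<beta> j) \<bullet> y)) \<le> t * (\<Sum>j\<in>J. \<bar>d j\<bar> * exp (rvec (\<beta> j) \<bullet> y))"
      using exp_nonneg[of y] GD by (simp add: reindex c_def inv)
    then show ?thesis using Dpos[of y] by simp
  qed
  define w where "w p = c p * exp (p \<bullet> y)" for p
  define e where "e j = t * \<bar>d j\<bar> * exp (rvec (\<beta> j) \<bullet> y)" for j
  have epos: "0 < e j" if "j \<in> J" for j using t d[OF that] by (simp add: e_def)
  define E where "E = sum e J"
  have E: "0 < E" unfolding E_def using J False epos by (intro sum_pos) auto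
  define x where "x = (1 / E) *\<^sub>R (\<Sum>j\<in>J. e j *\<^sub>R rvec (\<beta> j))"
  have mean: "(\<Sum>j\<in>J. e j *\<^sub>R rvec (\<beta> j)) = sum e J *\<^sub>R x"
    using E by (simp add: x_def E_def)
  have x: "x \<in> convex hull ((\<lambda>j. rvec (\<beta> j)) ` J)"
  proof -
    have "(\<Sum>j\<in>J. (e j / E) *\<^sub>R rvec (\<beta> j)) \<in> convex hull ((\<lambda>j. rvec (\<beta> j)) ` J)"
    proof (rule convex_sum[OF J convex_convex_hull])
      show "(\<Sum>j\<in>J. e j / E) = 1" using E by (simp add: E_def flip: sum_divide_distrib)
      show "0 \<le> e j / E" if "j \<in> J" for j using epos[OF that] E by simp
      show "rvec (\<beta> j) \<in> convex hull ((\<lambda>j. rvec (\<beta> j)) ` J)" if "j \<in> J" for j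
        using that by (intro hull_inc) auto
    qed
    then show ?thesis by (simp add: x_def scaleR_sum_right)
  qed
  have "(\<Sum>a\<in>A. Poly_Mapping.single a (w (rvec a) * exp (- (rvec a \<bullet> y))))
      - (\<Sum>j\<in>J. Poly_Mapping.single (\<beta> j) (d j)) \<in> SONC"
  proof (rule SONC_if_balanced[where e = e and x = x, OF A(1,2) _ J False epos])
    show "0 \<le> w p" if "p \<in> rvec ` A" for p
      using that A(3) by (auto simp: w_def c_def inv intro: less_imp_le)
    show "\<bar>d j\<bar> * exp (rvec (\<beta> j) \<bullet> y) \<le> e j" for j
      using mult_right_mono[OF \<open>1 \<le> t\<close>, of "\<bar>d j\<bar> * exp (rvec (\<beta> j) \<bullet> y)"]
      by (simp add: e_def mult.assoc)
    show "sum w (rvec ` A) = sum e J"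
      using GD by (simp add: w_def e_def sum_distrib_left mult.assoc)
    show "(\<Sum>p\<in>rvec ` A. w p *\<^sub>R p) = sum e J *\<^sub>R x"
      using crit mean by (simp add: w_def e_def)
    show "(\<Sum>j\<in>J. e j *\<^sub>R rvec (\<beta> j)) = sum e J *\<^sub>R x" by (rule mean)
    show "rvec (\<beta> j) \<in> rel_interior (convex hull T)"
      if "T \<subseteq> rvec ` A" "\<not> affine_dependent T" "x \<in> convex hull T" "j \<in> J" for T j
    proof -
      have "(\<lambda>j. rvec (\<beta> j)) ` J \<subseteq> rel_interior (convex hull T)"
      proof (rule chamber_subset_simplex[OF _ that(1,2) _ x that(3) side])
        show "affine hull (rvec ` A) = affine hull (New f)"
          by (simp add: New)
        show "(\<lambda>j. rvec (\<beta> j)) ` J \<subseteq> affine hull (New f)"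
          using inner rel_interior_subset hull_subset[of "New f" affine] by fast
      qed
      then show ?thesis using that(4) by auto
    qed
  qed
  moreover have "w (rvec a) * exp (- (rvec a \<bullet> y)) = C a" for a
    by (simp add: w_def c_def inv exp_minus)
  ultimately show ?thesis by (simp add: f)
qed

theorem theorem4p1:
  fixes f :: "'n::finite rpoly"
    and m l :: nat
    and c d :: "nat \<Rightarrow> real"
    and \<alpha> \<beta> :: "nat \<Rightarrow> nat ^ 'n"
  assumes "f = (\<Sum>i=1..m. Poly_Mapping.single (\<alpha> i) (c i))
             - (\<Sum>j=1..l. Poly_Mapping.single (\<beta> j) (d j))"
    and "\<And>i. i \<in> {1..m} \<Longrightarrow> even_exp (\<alpha> i)"
    and "\<And>i. i \<in> {1..m} \<Longrightarrow> 0 < c i"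
    and "\<And>j. j \<in> {1..l} \<Longrightarrow> rvec (\<beta> j) \<in> rel_interior (New f)"
    and "\<exists>w. simple_at (New f) w"
    and "\<And>H. H \<in> determined_hyperplanes (New f) ((\<lambda>i. rvec (\<alpha> i)) ` {1..m}) \<Longrightarrow>
           same_side (affine hull (New f)) H ((\<lambda>j. rvec (\<beta> j)) ` {1..l})"
    and "\<exists>v :: real ^ 'n. (\<forall>i. v $ i \<noteq> 0) \<and>
           (\<forall>j\<in>{1..l}. 0 < d j * mono_eval v (\<beta> j))"
  shows "f \<in> PSD \<longleftrightarrow> f \<in> SONC"
proof
  assume "f \<in> SONC"
  then show "f \<in> PSD" using SONC_subset_PSD by blast
next
  assume psd: "f \<in> PSD"
  define A where "A = \<alpha> ` {1..m}"
  \<comment> \<open>The exponents \<open>\<alpha> i\<close> may repeat, so the coefficients of equal ones are collected.\<close>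
  define C where "C a = (\<Sum>i | i \<in> {1..m} \<and> \<alpha> i = a. c i)" for a
  obtain v :: "real ^ 'n" where v: "\<And>i. v $ i \<noteq> 0" "\<And>j. j \<in> {1..l} \<Longrightarrow> 0 < d j * mono_eval v (\<beta> j)"
    using assms(7) by blast
  show "f \<in> SONC"
  proof (rule PSD_imp_SONC_one_chamber[where A = A and C = C and J = "{1..l}", OF _ _ _ _ _ assms(4) _ v psd])
    show "even_exp a" if "a \<in> A" for a using that assms(2) by (auto simp: A_def)
    show "0 < C a" if "a \<in> A" for a
      unfolding C_def using that assms(3) by (intro sum_pos) (auto simp: A_def)
    have "(\<Sum>a\<in>A. Poly_Mapping.single a (C a))
        = (\<Sum>a\<in>A. \<Sum>i | i \<in> {1..m} \<and> \<alpha> i = a. Poly_Mapping.single (\<alpha> i) (c i))"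
      by (simp add: C_def single_sum)
    also have "\<dots> = (\<Sum>i=1..m. Poly_Mapping.single (\<alpha> i) (c i))"
      by (rule sum.group) (auto simp: A_def)
    finally show "f = (\<Sum>a\<in>A. Poly_Mapping.single a (C a)) - (\<Sum>j=1..l. Poly_Mapping.single (\<beta> j) (d j))"
      by (simp add: assms(1))
  qed (use assms(6) in \<open>auto simp: A_def image_image\<close>)
qed

end
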